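(* Let $\lambda\in\mathbb{C}^*$, and for $i=1,2$ let $\alpha_i,\beta_i,\gamma_i\in\mathbb{C}$ with $\alpha_i\neq0$ or $\beta_i\neq0$, and $h_i(t_i)\in\mathbb{C}[t_i]$. Identify the vector space $\Phi(\lambda,\alpha_1,\beta_1,\gamma_1,h_1(t_1))\otimes\Phi(\lambda,\alpha_2,\beta_2,\gamma_2,h_2(t_2))$ with $\mathbb{C}[s_1,s_2,t_1,t_2]$ (where the $i$-th factor is $\mathbb{C}[s_i,t_i]$). For $l\in\mathbb{Z}_+$ let $$N_l=\operatorname{span}\{s_1^r(s_1+s_2)^u\,g(t_1,t_2)\mid r,u\in\mathbb{Z}_+,\ r\leq l,\ g\in\mathbb{C}[t_1,t_2]\}.$$ Then for each $l\in\mathbb{Z}_+$, $N_l$ is a proper submodule of the $\mathfrak{L}$-module $\Phi(\lambda,\alpha_1,\beta_1,\gamma_1,h_1(t_1))\otimes\Phi(\lambda,\alpha_2,\beta_2,\gamma_2,h_2(t_2))$.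
   Context: All vector spaces are over $\mathbb{C}$; $\mathbb{C}^*$ denotes the nonzero complex numbers, $\mathbb{Z}_+$ the nonnegative integers. The BMS-Kac-Moody algebra $\mathfrak{L}$ is the Lie algebra with basis $\{L_m,W_m,I_m,J_m\mid m\in\mathbb{Z}\}$ and nontrivial brackets $[L_m,L_n]=(n-m)L_{m+n}$, $[L_m,W_n]=(n-m)W_{m+n}$, $[L_m,I_n]=nI_{m+n}$, $[L_m,J_n]=nJ_{m+n}$, $[W_m,I_n]=-nJ_{m+n}$ for $m,n\in\mathbb{Z}$ (all other brackets of basis elements, up to skew-symmetry, are zero). For $\lambda\in\mathbb{C}^*$, $\alpha,\beta,\gamma\in\mathbb{C}$, $h(t)\in\mathbb{C}[t]$, the $\mathfrak{L}$-module $\Phi(\lambda,\alpha,\beta,\gamma,h(t))$ is the vector space $\mathbb{C}[s,t]$ with, for $f(s,t)\in\mathbb{C}[s,t]$ and $n\in\mathbb{Z}$, $L_n(f(s,t))=\lambda^n(s+h_{(n)}(t))f(s-n,t)-n\lambda^n(t-n\alpha)\frac{\partial}{\partial t}(f(s-n,t))$, $W_n(f(s,t))=\lambda^n(t-n\alpha)f(s-n,t)$, $I_n(f(s,t))=\lambda^n\big(\gamma-n\beta H(t)\big)f(s-n,t)+n\lambda^n\beta\frac{\partial}{\partial t}(f(s-n,t))$, $J_n(f(s,t))=\lambda^n\beta f(s-n,t)$, where $H(t)=\frac{h(t)-h(\alpha)}{t-\alpha}$ and $h_{(n)}(t)=nh(t)-n(n-1)\alpha H(t)$. The tensor product of two $\mathfrak{L}$-modules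 carries the usual action $x(a\otimes b)=xa\otimes b+a\otimes xb$. *)

theory Defs
  imports Complex_Main "HOL-Library.Poly_Mapping" "HOL-Computational_Algebra.Polynomial"
begin

section \<open>Lie algebras, modules, submodules\<close>

locale lie_algebra = vector_space scale
  for scale :: "'k::field \<Rightarrow> 'g::ab_group_add \<Rightarrow> 'g" +
  fixes bracket :: "'g \<Rightarrow> 'g \<Rightarrow> 'g"
  assumes bracket_linear_left: "Vector_Spaces.linear scale scale (\<lambda>x. bracket x y)"
    and bracket_linear_right: "Vector_Spaces.linear scale scale (\<lambda>y. bracket x y)"
    and bracket_self: "bracket x x = 0"
    and jacobi: "bracket x (bracket y z) + bracket y (bracket z x) + bracket z (bracket x y) = 0"

locale lie_module = lie_algebra scale bracket + V: vector_space vscale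
  for scale :: "'k::field \<Rightarrow> 'g::ab_group_add \<Rightarrow> 'g"
    and bracket :: "'g \<Rightarrow> 'g \<Rightarrow> 'g"
    and vscale :: "'k \<Rightarrow> 'v::ab_group_add \<Rightarrow> 'v" +
  fixes act :: "'g \<Rightarrow> 'v \<Rightarrow> 'v"
  assumes act_linear_left: "Vector_Spaces.linear scale vscale (\<lambda>x. act x v)"
    and act_linear_right: "Vector_Spaces.linear vscale vscale (\<lambda>v. act x v)"
    and act_bracket: "act (bracket x y) v = act x (act y v) - act y (act x v)"

locale lie_submodule = lie_module scale bracket vscale act
  for scale :: "'k::field \<Rightarrow> 'g::ab_group_add \<Rightarrow> 'g"
    and bracket :: "'g \<Rightarrow> 'g \<Rightarrow> 'g"
    and vscale :: "'k \<Rightarrow> 'v::ab_group_add \<Rightarrow> 'v"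
    and act :: "'g \<Rightarrow> 'v \<Rightarrow> 'v" +
  fixes N :: "'v set"
  assumes subspace_N: "V.subspace N"
    and act_closed: "v \<in> N \<Longrightarrow> act x v \<in> N"


section \<open>The BMS-Kac-Moody algebra\<close>

datatype bms_basis = Lgen int | Wgen int | Igen int | Jgen int

text \<open>Finitely supported functions on the index type of the basis: the basis vector
  belonging to \<open>b\<close> is \<open>Poly_Mapping.single b 1\<close>.\<close>

type_synonym bms = "bms_basis \<Rightarrow>\<^sub>0 complex"

definition bms_scale :: "complex \<Rightarrow> bms \<Rightarrow> bms" where
  "bms_scale c x = Poly_Mapping.map ((*) c) x"

text \<open>The equations with \<open>Lgen\<close> in the second place, and the one for \<open>Igen\<close>, \<open>Wgen\<close>, are
  those forced by skew-symmetry.\<close>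

fun bms_basis_bracket :: "bms_basis \<Rightarrow> bms_basis \<Rightarrow> bms" where
  "bms_basis_bracket (Lgen m) (Lgen n) = Poly_Mapping.single (Lgen (m + n)) (of_int (n - m))"
| "bms_basis_bracket (Lgen m) (Wgen n) = Poly_Mapping.single (Wgen (m + n)) (of_int (n - m))"
| "bms_basis_bracket (Lgen m) (Igen n) = Poly_Mapping.single (Igen (m + n)) (of_int n)"
| "bms_basis_bracket (Lgen m) (Jgen n) = Poly_Mapping.single (Jgen (m + n)) (of_int n)"
| "bms_basis_bracket (Wgen m) (Igen n) = Poly_Mapping.single (Jgen (m + n)) (- of_int n)"
| "bms_basis_bracket (Wgen m) (Lgen n) = - Poly_Mapping.single (Wgen (n + m)) (of_int (m - n))"
| "bms_basis_bracket (Igen m) (Lgen n) = - Poly_Mapping.single (Igen (n + m)) (of_int m)"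
| "bms_basis_bracket (Jgen m) (Lgen n) = - Poly_Mapping.single (Jgen (n + m)) (of_int m)"
| "bms_basis_bracket (Igen m) (Wgen n) = - Poly_Mapping.single (Jgen (n + m)) (- of_int m)"
| "bms_basis_bracket _ _ = 0"

definition bms_bracket :: "bms \<Rightarrow> bms \<Rightarrow> bms" where
  "bms_bracket x y =
     (\<Sum>a\<in>Poly_Mapping.keys x. \<Sum>b\<in>Poly_Mapping.keys y.
        bms_scale (Poly_Mapping.lookup x a * Poly_Mapping.lookup y b) (bms_basis_bracket a b))"


section \<open>The modules $\Phi(\lambda,\alpha,\beta,\gamma,h(t))$\<close>

text \<open>$\mathbb{C}[s,t]$ is $\mathbb{C}[t][s]$: the outer variable is $s$, the inner one $t$.\<close>

type_synonym poly_st = "complex poly poly"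

definition scale_st :: "complex \<Rightarrow> poly_st \<Rightarrow> poly_st" where
  "scale_st c f = smult [:c:] f"

definition var_s :: poly_st where
  "var_s = [:0, 1:]"

definition in_t :: "complex poly \<Rightarrow> poly_st" where
  "in_t p = [:p:]"

text \<open>$f(s-n,t)$\<close>

definition shift_s :: "int \<Rightarrow> poly_st \<Rightarrow> poly_st" where
  "shift_s n f = pcompose f [:- of_int n, 1:]"

text \<open>$\partial f/\partial t$\<close>

definition deriv_t :: "poly_st \<Rightarrow> poly_st" where
  "deriv_t f = map_poly pderiv f"

text \<open>$H(t)=(h(t)-h(\alpha))/(t-\alpha)$; the division is exact.\<close>

definition H_poly :: "complex \<Rightarrow> complex poly \<Rightarrow> complex poly" where
  "H_poly \<alpha> h = (h - [:poly h \<alpha>:]) div [:- \<alpha>, 1:]"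

definition h_sub :: "complex \<Rightarrow> complex poly \<Rightarrow> int \<Rightarrow> complex poly" where
  "h_sub \<alpha> h n = smult (of_int n) h - smult (of_int (n * (n - 1)) * \<alpha>) (H_poly \<alpha> h)"

fun phi_basis :: "complex \<Rightarrow> complex \<Rightarrow> complex \<Rightarrow> complex \<Rightarrow> complex poly
    \<Rightarrow> bms_basis \<Rightarrow> poly_st \<Rightarrow> poly_st" where
  "phi_basis lam \<alpha> \<beta> \<gamma> h (Lgen n) f =
     scale_st (lam powi n) ((var_s + in_t (h_sub \<alpha> h n)) * shift_s n f)
     - scale_st (of_int n * lam powi n) (in_t [:- of_int n * \<alpha>, 1:] * deriv_t (shift_s n f))"
| "phi_basis lam \<alpha> \<beta> \<gamma> h (Wgen n) f =
     scale_st (lam powi n) (in_t [:- of_int n * \<alpha>, 1:] * shift_s n f)"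
| "phi_basis lam \<alpha> \<beta> \<gamma> h (Igen n) f =
     scale_st (lam powi n)
       (in_t ([:\<gamma>:] - smult (of_int n * \<beta>) (H_poly \<alpha> h)) * shift_s n f)
     + scale_st (of_int n * lam powi n * \<beta>) (deriv_t (shift_s n f))"
| "phi_basis lam \<alpha> \<beta> \<gamma> h (Jgen n) f =
     scale_st (lam powi n * \<beta>) (shift_s n f)"

definition phi_act :: "complex \<Rightarrow> complex \<Rightarrow> complex \<Rightarrow> complex \<Rightarrow> complex poly
    \<Rightarrow> bms \<Rightarrow> poly_st \<Rightarrow> poly_st" where
  "phi_act lam \<alpha> \<beta> \<gamma> h x f =
     (\<Sum>b\<in>Poly_Mapping.keys x. scale_st (Poly_Mapping.lookup x b) (phi_basis lam \<alpha> \<beta> \<gamma> h b f))"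


section \<open>Tensor products on $\mathbb{C}[s_1,s_2,t_1,t_2]$\<close>

text \<open>$\mathbb{C}[s_1,s_2,t_1,t_2]$ is $\mathbb{C}[s_2,t_2][t_1][s_1]$: from the outermost to
  the innermost level, the variables are $s_1$, $t_1$, $s_2$, $t_2$.\<close>

type_synonym poly_sstt = "poly_st poly poly"

definition scale_sstt :: "complex \<Rightarrow> poly_sstt \<Rightarrow> poly_sstt" where
  "scale_sstt c F = smult [:[:[:c:]:]:] F"

text \<open>The inclusions of $\mathbb{C}[s_1,t_1]$, $\mathbb{C}[s_2,t_2]$ and
  $\mathbb{C}[t_1,t_2]=\mathbb{C}[t_2][t_1]$.\<close>

definition emb1 :: "poly_st \<Rightarrow> poly_sstt" where
  "emb1 f = map_poly (map_poly (\<lambda>c. [:[:c:]:])) f"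

definition emb2 :: "poly_st \<Rightarrow> poly_sstt" where
  "emb2 g = [:[:g:]:]"

definition emb_tt :: "complex poly poly \<Rightarrow> poly_sstt" where
  "emb_tt g = [:map_poly in_t g:]"

text \<open>The identification of $\mathbb{C}[s_1,t_1]\otimes\mathbb{C}[s_2,t_2]$ with
  $\mathbb{C}[s_1,s_2,t_1,t_2]$ on pure tensors.\<close>

definition pure_tensor :: "poly_st \<Rightarrow> poly_st \<Rightarrow> poly_sstt" (infixl "\<otimes>\<^sub>p" 72) where
  "f \<otimes>\<^sub>p g = emb1 f * emb2 g"

definition monom_st :: "nat \<Rightarrow> nat \<Rightarrow> poly_st" where
  "monom_st i j = monom (monom 1 j) i"

text \<open>The tensor product action.  It is given through the expansion
  $F=\sum_{i,j} s_1^it_1^j\otimes F_{ij}$ with $F_{ij}\in\mathbb{C}[s_2,t_2]$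
  (see \<open>pure_tensor_expansion\<close>); \<open>tensor_act_pure\<close> shows that
  $x(f\otimes g)=xf\otimes g+f\otimes xg$.\<close>

definition tensor_act :: "('g \<Rightarrow> poly_st \<Rightarrow> poly_st) \<Rightarrow> ('g \<Rightarrow> poly_st \<Rightarrow> poly_st)
    \<Rightarrow> 'g \<Rightarrow> poly_sstt \<Rightarrow> poly_sstt" where
  "tensor_act act1 act2 x F =
     (\<Sum>i\<le>degree F. \<Sum>j\<le>degree (coeff F i).
        act1 x (monom_st i j) \<otimes>\<^sub>p coeff (coeff F i) j
        + monom_st i j \<otimes>\<^sub>p act2 x (coeff (coeff F i) j))"

definition phi_tensor_act :: "complex
    \<Rightarrow> complex \<Rightarrow> complex \<Rightarrow> complex \<Rightarrow> complex poly
    \<Rightarrow> complex \<Rightarrow> complex \<Rightarrow> complex \<Rightarrow> complex poly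
    \<Rightarrow> bms \<Rightarrow> poly_sstt \<Rightarrow> poly_sstt" where
  "phi_tensor_act lam \<alpha>\<^sub>1 \<beta>\<^sub>1 \<gamma>\<^sub>1 h\<^sub>1 \<alpha>\<^sub>2 \<beta>\<^sub>2 \<gamma>\<^sub>2 h\<^sub>2 =
     tensor_act (phi_act lam \<alpha>\<^sub>1 \<beta>\<^sub>1 \<gamma>\<^sub>1 h\<^sub>1) (phi_act lam \<alpha>\<^sub>2 \<beta>\<^sub>2 \<gamma>\<^sub>2 h\<^sub>2)"

definition N_sub :: "nat \<Rightarrow> poly_sstt set" where
  "N_sub l = module.span scale_sstt
     {emb1 var_s ^ r * (emb1 var_s + emb2 var_s) ^ u * emb_tt g | r u g. r \<le> l}"


section \<open>The tensor product action on pure tensors\<close>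

lemma vector_space_scale_st: "vector_space scale_st"
  by unfold_locales (simp_all add: scale_st_def smult_add_right mult.commute flip: smult_add_left one_pCons)

lemma linear_stI:
  assumes "\<And>f g. F (f + g) = F f + F g" "\<And>c f. F (scale_st c f) = scale_st c (F f)"
  shows "Vector_Spaces.linear scale_st scale_st F"
  using assms vector_space_scale_st
  by (simp add: Vector_Spaces.linear_def module_hom_def module_hom_axioms_def
      module_iff_vector_space)

lemma linear_st_add: "Vector_Spaces.linear scale_st scale_st F \<Longrightarrow> F (f + g) = F f + F g"
  by (auto simp: Vector_Spaces.linear_def intro: module_hom.add)

lemma linear_st_scale:
  "Vector_Spaces.linear scale_st scale_st F \<Longrightarrow> F (scale_st c f) = scale_st c (F f)"
  by (auto simp: Vector_Spaces.linear_def intro: module_hom.scale)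

lemma linear_st_sum:
  "Vector_Spaces.linear scale_st scale_st F \<Longrightarrow> F (\<Sum>a\<in>A. f a) = (\<Sum>a\<in>A. F (f a))"
  by (auto simp: Vector_Spaces.linear_def intro: module_hom.sum)

lemma scale_st_add: "scale_st c (f + g) = scale_st c f + scale_st c g"
  by (simp add: scale_st_def smult_add_right)

lemma scale_st_diff: "scale_st c (f - g) = scale_st c f - scale_st c g"
  by (simp add: scale_st_def smult_diff_right)

lemma scale_st_scale: "scale_st c (scale_st d f) = scale_st (c * d) f"
  by (simp add: scale_st_def mult.commute)

lemma scale_st_left_commute: "scale_st c (scale_st d f) = scale_st d (scale_st c f)"
  by (simp add: scale_st_scale mult.commute)

lemma scale_st_sum: "scale_st c (\<Sum>a\<in>A. f a) = (\<Sum>a\<in>A. scale_st c (f a))"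
  by (induction A rule: infinite_finite_induct) (simp_all add: scale_st_add, simp_all add: scale_st_def)

lemma mult_scale_st: "f * scale_st c g = scale_st c (f * g)"
  by (simp add: scale_st_def)

lemma shift_s_add: "shift_s n (f + g) = shift_s n f + shift_s n g"
  by (simp add: shift_s_def pcompose_add)

lemma shift_s_scale: "shift_s n (scale_st c f) = scale_st c (shift_s n f)"
  by (simp add: shift_s_def scale_st_def pcompose_smult)

lemma deriv_t_add: "deriv_t (f + g) = deriv_t f + deriv_t g"
  by (simp add: deriv_t_def poly_eq_iff coeff_map_poly pderiv_add)

lemma deriv_t_scale: "deriv_t (scale_st c f) = scale_st c (deriv_t f)"
  by (simp add: deriv_t_def scale_st_def poly_eq_iff[where 'a = "complex poly"]
      coeff_map_poly pderiv_smult)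

lemma linear_phi_basis:
  "Vector_Spaces.linear scale_st scale_st (phi_basis lam \<alpha> \<beta> \<gamma> h b)"
  by (rule linear_stI; cases b)
    (simp_all add: shift_s_add shift_s_scale deriv_t_add deriv_t_scale distrib_left
      scale_st_add scale_st_diff mult_scale_st scale_st_left_commute)

lemma linear_phi_act: "Vector_Spaces.linear scale_st scale_st (phi_act lam \<alpha> \<beta> \<gamma> h x)"
  by (rule linear_stI)
    (simp_all add: phi_act_def linear_st_add[OF linear_phi_basis]
      linear_st_scale[OF linear_phi_basis] scale_st_add sum.distrib scale_st_sum
      scale_st_scale mult.commute)

lemma coeff_emb1: "coeff (coeff (emb1 f) i) j = [:[:coeff (coeff f i) j:]:]"
  by (simp add: emb1_def coeff_map_poly)

lemma coeff_pure_tensor: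
  "coeff (coeff (f \<otimes>\<^sub>p g) i) j = scale_st (coeff (coeff f i) j) g"
  by (simp add: pure_tensor_def emb2_def scale_st_def coeff_emb1 mult.commute)

lemma sstt_eqI: "(\<And>i j. coeff (coeff F i) j = coeff (coeff G i) j) \<Longrightarrow> F = (G :: poly_sstt)"
  by (simp add: poly_eq_iff)

lemma pure_tensor_add_left: "(f + f') \<otimes>\<^sub>p g = f \<otimes>\<^sub>p g + f' \<otimes>\<^sub>p g"
  by (rule sstt_eqI) (simp add: coeff_pure_tensor scale_st_def flip: smult_add_left)

lemma pure_tensor_add_right: "f \<otimes>\<^sub>p (g + g') = f \<otimes>\<^sub>p g + f \<otimes>\<^sub>p g'"
  by (rule sstt_eqI) (simp add: coeff_pure_tensor scale_st_add)

lemma pure_tensor_scale: "scale_st c f \<otimes>\<^sub>p g = f \<otimes>\<^sub>p scale_st c g"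
  by (rule sstt_eqI) (simp add: coeff_pure_tensor scale_st_def mult.commute)

lemma pure_tensor_0 [simp]: "0 \<otimes>\<^sub>p g = 0" "f \<otimes>\<^sub>p 0 = 0"
  by (rule sstt_eqI; simp add: coeff_pure_tensor scale_st_def)+

lemma pure_tensor_sum_left: "(\<Sum>a\<in>A. f a) \<otimes>\<^sub>p g = (\<Sum>a\<in>A. f a \<otimes>\<^sub>p g)"
  by (induction A rule: infinite_finite_induct) (simp_all add: pure_tensor_add_left)

lemma expansion:
  fixes F :: "'a::comm_monoid_add poly poly"
  shows "F = (\<Sum>i\<le>degree F. \<Sum>j\<le>degree (coeff F i). monom (monom (coeff (coeff F i) j) j) i)"
proof -
  have "(\<Sum>j\<le>degree p. monom (monom (coeff p j) j) i) = monom p i" for p :: "'a poly" and i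
  proof -
    have "(\<Sum>j\<le>degree p. monom (monom (coeff p j) j) i) = monom (\<Sum>j\<le>degree p. monom (coeff p j) j) i"
      by (simp add: poly_eq_iff coeff_sum if_distrib cong: if_cong) 
    then show ?thesis
      by (simp add: poly_as_sum_of_monoms)
  qed
  then show ?thesis
    by (simp add: poly_as_sum_of_monoms)
qed

lemma monom_st_pure_tensor: "monom_st i j \<otimes>\<^sub>p g = monom (monom g j) i"
  by (rule sstt_eqI) (simp add: coeff_pure_tensor monom_st_def scale_st_def flip: one_pCons)

lemma pure_tensor_expansion:
  "F = (\<Sum>i\<le>degree F. \<Sum>j\<le>degree (coeff F i). monom_st i j \<otimes>\<^sub>p coeff (coeff F i) j)"
  unfolding monom_st_pure_tensor by (rule expansion)

lemma st_expansion:
  "f = (\<Sum>i\<le>degree f. \<Sum>j\<le>degree (coeff f i). scale_st (coeff (coeff f i) j) (monom_st i j))"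
proof -
  have "scale_st c (monom_st i j) = monom (monom c j) i" for c i j
    by (simp add: scale_st_def monom_st_def smult_monom)
  then show ?thesis
    using expansion[of f] by simp
qed

lemma tensor_act_pure:
  assumes lin1: "Vector_Spaces.linear scale_st scale_st (act1 x)"
    and lin2: "Vector_Spaces.linear scale_st scale_st (act2 x)"
  shows "tensor_act act1 act2 x (f \<otimes>\<^sub>p g) = act1 x f \<otimes>\<^sub>p g + f \<otimes>\<^sub>p act2 x g"
proof (cases "g = 0")
  case True
  have "act2 x 0 = 0"
    using linear_st_add[OF lin2, of 0 0] by simp
  moreover have "act1 x 0 \<otimes>\<^sub>p 0 = 0"
    by simp
  ultimately show ?thesis
    using True by (simp add: tensor_act_def)
next
  case False
  let ?c = "\<lambda>i j. coeff (coeff f i) j"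
  have deg: "degree (f \<otimes>\<^sub>p g) = degree f" "degree (coeff (f \<otimes>\<^sub>p g) i) = degree (coeff f i)" for i
    using False
    by (simp_all add: pure_tensor_def emb1_def emb2_def degree_map_poly coeff_map_poly
        map_poly_eq_0_iff degree_mult_eq)
  have "tensor_act act1 act2 x (f \<otimes>\<^sub>p g) =
      (\<Sum>i\<le>degree f. \<Sum>j\<le>degree (coeff f i).
        act1 x (scale_st (?c i j) (monom_st i j)) \<otimes>\<^sub>p g
        + scale_st (?c i j) (monom_st i j) \<otimes>\<^sub>p act2 x g)"
    by (simp add: tensor_act_def deg coeff_pure_tensor linear_st_scale[OF lin1]
        linear_st_scale[OF lin2] pure_tensor_scale)
  also have "\<dots> = act1 x (\<Sum>i\<le>degree f. \<Sum>j\<le>degree (coeff f i).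
          scale_st (?c i j) (monom_st i j)) \<otimes>\<^sub>p g
      + (\<Sum>i\<le>degree f. \<Sum>j\<le>degree (coeff f i). scale_st (?c i j) (monom_st i j)) \<otimes>\<^sub>p act2 x g"
    by (simp add: linear_st_sum[OF lin1] pure_tensor_sum_left sum.distrib)
  finally show ?thesis
    by (simp flip: st_expansion)
qed

lemma phi_tensor_act_pure:
  "phi_tensor_act lam \<alpha>\<^sub>1 \<beta>\<^sub>1 \<gamma>\<^sub>1 h\<^sub>1 \<alpha>\<^sub>2 \<beta>\<^sub>2 \<gamma>\<^sub>2 h\<^sub>2 x (f \<otimes>\<^sub>p g) =
     phi_act lam \<alpha>\<^sub>1 \<beta>\<^sub>1 \<gamma>\<^sub>1 h\<^sub>1 x f \<otimes>\<^sub>p g + f \<otimes>\<^sub>p phi_act lam \<alpha>\<^sub>2 \<beta>\<^sub>2 \<gamma>\<^sub>2 h\<^sub>2 x g"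
  unfolding phi_tensor_act_def by (intro tensor_act_pure linear_phi_act)

end

theory Submission
  imports Defs
begin

text \<open>All commutators are checked on basis elements. On $\mathbb{C}[s,t]$, with
  $D = H - \partial_t$ and $\sigma_n$ the shift $s \mapsto s - n$, the basis acts by
  $L_n = \lambda^n (s + n h(\alpha) + n (t - n\alpha) D) \sigma_n$,
  $W_n = \lambda^n (t - n\alpha) \sigma_n$, $I_n = \lambda^n (\gamma - n\beta D) \sigma_n$ and
  $J_n = \lambda^n \beta \sigma_n$, where $[t, D] = 1$. On the tensor product the only term of
  $L_n (s_1^r (s_1+s_2)^u g)$ that could leave $N_l$ is $\lambda^n (s_1+s_2-n)^u g$ times
  $s_1 (s_1-n)^r + s_2 s_1^r = s_1 ((s_1-n)^r - s_1^r) + (s_1+s_2) s_1^r$, whose degree in $s_1$ over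
  $\mathbb{C}[s_1+s_2]$ is at most $r$; this uses that both factors have the same $\lambda$.
  Properness: restricted to $s_2 = -s_1$, $t_1 = t_2 = 0$, elements of $N_l$ have degree at most $l$
  in $s_1$, whereas $s_1^{l+1}$ has degree $l+1$.\<close>

section \<open>The BMS-Kac-Moody algebra is a Lie algebra\<close>

lemma linearI_vs:
  assumes "vector_space s1" "vector_space s2"
    and "\<And>x y. f (x + y) = f x + f y" "\<And>c x. f (s1 c x) = s2 c (f x)"
  shows "Vector_Spaces.linear s1 s2 f"
  using assms by (simp add: Vector_Spaces.linear_iff)

lemma lookup_bms_scale [simp]:
  "Poly_Mapping.lookup (bms_scale c x) b = c * Poly_Mapping.lookup x b"
  by (simp add: bms_scale_def Poly_Mapping.map.rep_eq when_def)

lemma vector_space_bms: "vector_space bms_scale"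
  by unfold_locales (rule poly_mapping_eqI; simp add: lookup_add algebra_simps)+

interpretation bms: vector_space bms_scale
  by (rule vector_space_bms)

lemma bms_scale_single: "bms_scale c (Poly_Mapping.single b d) = Poly_Mapping.single b (c * d)"
  by (rule poly_mapping_eqI) (simp add: lookup_single when_def)

lemma bms_single_scale: "Poly_Mapping.single b c = bms_scale c (Poly_Mapping.single b 1)"
  by (simp add: bms_scale_single)

lemma keys_bms_scale: "Poly_Mapping.keys (bms_scale c x) \<subseteq> Poly_Mapping.keys x"
  by (auto simp: in_keys_iff)

text \<open>Coefficients vanish off the support, so any finite superset serves; the sums for x, y
  and x + y can then share one index set even when terms cancel.\<close>

lemma sum_keys_mono_neutral:
  assumes "vector_space sc" "finite B" "Poly_Mapping.keys x \<subseteq> B"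
  shows "(\<Sum>b\<in>Poly_Mapping.keys x. sc (Poly_Mapping.lookup x b) (\<phi> b))
    = (\<Sum>b\<in>B. sc (Poly_Mapping.lookup x b) (\<phi> b))"
proof -
  interpret vector_space sc by fact
  show ?thesis
    using assms(2,3) by (intro sum.mono_neutral_left) (auto simp: in_keys_iff)
qed

text \<open>Linear extension from the basis: the bracket in either argument and
  \<open>phi_act\<close> in its Lie algebra argument all have this shape.\<close>

lemma linear_sum_keys:
  assumes "vector_space sc"
  shows "Vector_Spaces.linear bms_scale sc
    (\<lambda>x. \<Sum>b\<in>Poly_Mapping.keys x. sc (Poly_Mapping.lookup x b) (\<phi> b))"
    (is "Vector_Spaces.linear _ _ ?F")
proof -
  interpret vector_space sc by fact
  show ?thesis
  proof (rule linearI_vs[OF vector_space_bms assms])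
    fix x y :: bms and c
    let ?B = "Poly_Mapping.keys x \<union> Poly_Mapping.keys y"
    have *: "?F z = (\<Sum>b\<in>?B. sc (Poly_Mapping.lookup z b) (\<phi> b))" if "z \<in> {x, y, x + y}" for z
      using that keys_add[of x y] by (intro sum_keys_mono_neutral[OF assms]) auto
    show "?F (x + y) = ?F x + ?F y"
      unfolding *[of x, simplified] *[of y, simplified] *[of "x + y", simplified]
      by (simp add: lookup_add scale_left_distrib sum.distrib)
    have "?F (bms_scale c x) =
      (\<Sum>b\<in>Poly_Mapping.keys x. sc (Poly_Mapping.lookup (bms_scale c x) b) (\<phi> b))"
      by (intro sum_keys_mono_neutral[OF assms] keys_bms_scale finite_keys)
    then show "?F (bms_scale c x) = sc c (?F x)"
      by (simp add: scale_sum_right)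
  qed
qed

lemma bms_induct [case_names zero add single]:
  assumes "P 0" "\<And>x y. P x \<Longrightarrow> P y \<Longrightarrow> P (x + y)"
    and "\<And>c b. P (bms_scale c (Poly_Mapping.single b 1))"
  shows "P x"
proof (induction x rule: update_induct)
  case const
  then show ?case by (rule assms(1))
next
  case (update f a b)
  \<comment> \<open>The updated key lies outside the support of f, so overwriting amounts to
    adding.\<close>
  have "Poly_Mapping.update a b f = f + bms_scale b (Poly_Mapping.single a 1)"
    using update
    by (intro poly_mapping_eqI) (auto simp: lookup_update lookup_add lookup_single when_def in_keys_iff)
  with update show ?case
    using assms(2,3) by simp
qed

lemma linear_bms_bracket_left:
  "Vector_Spaces.linear bms_scale bms_scale (\<lambda>x. bms_bracket x y)"
proof -
  have "bms_bracket x y = (\<Sum>a\<in>Poly_Mapping.keys x. bms_scale (Poly_Mapping.lookup x a)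
      (\<Sum>b\<in>Poly_Mapping.keys y. bms_scale (Poly_Mapping.lookup y b) (bms_basis_bracket a b)))" for x
    by (simp add: bms_bracket_def bms.scale_sum_right)
  then show ?thesis
    using linear_sum_keys[OF vector_space_bms] by simp
qed

lemma linear_bms_bracket_right:
  "Vector_Spaces.linear bms_scale bms_scale (\<lambda>y. bms_bracket x y)"
proof -
  have "bms_bracket x y = (\<Sum>b\<in>Poly_Mapping.keys y. bms_scale (Poly_Mapping.lookup y b)
      (\<Sum>a\<in>Poly_Mapping.keys x. bms_scale (Poly_Mapping.lookup x a) (bms_basis_bracket a b)))" for y
    unfolding bms_bracket_def by (subst sum.swap) (simp add: bms.scale_sum_right mult.commute)
  then show ?thesis
    using linear_sum_keys[OF vector_space_bms] by simp
qed

interpretation bracket_left: Vector_Spaces.linear bms_scale bms_scale "\<lambda>x. bms_bracket x y" for y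
  by (rule linear_bms_bracket_left)

interpretation bracket_right: Vector_Spaces.linear bms_scale bms_scale "\<lambda>y. bms_bracket x y" for x
  by (rule linear_bms_bracket_right)

lemma bms_bracket_single_1:
  "bms_bracket (Poly_Mapping.single a 1) (Poly_Mapping.single b 1) = bms_basis_bracket a b"
  by (simp add: bms_bracket_def)

lemma bms_bracket_single:
  "bms_bracket (Poly_Mapping.single a c) (Poly_Mapping.single b d)
    = bms_scale (c * d) (bms_basis_bracket a b)"
  by (simp add: bms_single_scale[of a c] bms_single_scale[of b d] bracket_left.scale
      bracket_right.scale bms_bracket_single_1 mult.commute)

lemma bms_basis_bracket_swap: "bms_basis_bracket b a = - bms_basis_bracket a b"
  by (cases a; cases b)
    (simp_all add: add.commute single_uminus single_diff)

lemmas bms_bracket_bilinear = bracket_left.add bracket_left.scale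
  bracket_right.add bracket_right.scale

lemma bms_bracket_swap: "bms_bracket y x = - bms_bracket x y"
proof -
  \<comment> \<open>Bilinearity is used one argument at a time: first against a basis vector, then
    in general.\<close>
  have "bms_bracket y (Poly_Mapping.single a 1) = - bms_bracket (Poly_Mapping.single a 1) y" for a y
    by (induction y rule: bms_induct)
      (simp_all add: bms_bracket_bilinear bms_bracket_single_1 bms_basis_bracket_swap[of a])
  then show ?thesis
    by (induction x rule: bms_induct) (simp_all add: bms_bracket_bilinear)
qed

text \<open>Antisymmetry gives v = -v, which forces v = 0 because the coefficients are complex
  numbers.\<close>

lemma bms_bracket_self: "bms_bracket x x = 0"
proof (rule poly_mapping_eqI)
  fix b
  have "Poly_Mapping.lookup (bms_bracket x x) b = - Poly_Mapping.lookup (bms_bracket x x) b"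
    using bms_bracket_swap[of x x] by (metis lookup_uminus)
  then show "Poly_Mapping.lookup (bms_bracket x x) b = Poly_Mapping.lookup 0 b"
    by simp
qed

text \<open>A check of the 64 combinations of generator types. In each, the three terms are
  multiples of one basis vector, so an identity between integer coefficients remains.\<close>

lemma bms_jacobi_basis:
  fixes a b c
  defines "x \<equiv> Poly_Mapping.single a 1" and "y \<equiv> Poly_Mapping.single b 1"
    and "z \<equiv> Poly_Mapping.single c 1"
  shows "bms_bracket x (bms_bracket y z) + bms_bracket y (bms_bracket z x)
    + bms_bracket z (bms_bracket x y) = 0"
  unfolding x_def y_def z_def bms_bracket_single_1
  by (cases a; cases b; cases c)
    (simp_all add: bms_bracket_single bms_scale_single bracket_right.neg bracket_right.zero
      algebra_simps flip: single_add single_diff single_uminus)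

lemma bms_jacobi:
  "bms_bracket x (bms_bracket y z) + bms_bracket y (bms_bracket z x)
    + bms_bracket z (bms_bracket x y) = 0"
proof -
  \<comment> \<open>The Jacobi sum is trilinear, so its vanishing on basis triples spreads to
    arbitrary elements in one argument after another.\<close>
  define J where "J x y z = bms_bracket x (bms_bracket y z) + bms_bracket y (bms_bracket z x)
    + bms_bracket z (bms_bracket x y)" for x y z
  have add: "J (x + x') y z = J x y z + J x' y z" "J x (y + y') z = J x y z + J x y' z"
    "J x y (z + z') = J x y z + J x y z'" for x x' y y' z z'
    by (simp_all add: J_def bms_bracket_bilinear algebra_simps)
  have scale: "J (bms_scale c x) y z = bms_scale c (J x y z)"
    "J x (bms_scale c y) z = bms_scale c (J x y z)"
    "J x y (bms_scale c z) = bms_scale c (J x y z)" for c x y z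
    by (simp_all add: J_def bms_bracket_bilinear bms.scale_right_distrib)
  have zero: "J 0 y z = 0" "J x 0 z = 0" "J x y 0 = 0" for x y z
    by (simp_all add: J_def bms_bracket_bilinear)
  have basis: "J (Poly_Mapping.single a 1) (Poly_Mapping.single b 1) (Poly_Mapping.single c 1) = 0"
    for a b c
    using bms_jacobi_basis by (simp add: J_def)
  have "J (Poly_Mapping.single a 1) (Poly_Mapping.single b 1) z = 0" for a b z
    by (induction z rule: bms_induct) (simp_all add: add scale zero basis)
  then have "J (Poly_Mapping.single a 1) y z = 0" for a y z
    by (induction y rule: bms_induct) (simp_all add: add scale zero)
  then have "J x y z = 0"
    by (induction x rule: bms_induct) (simp_all add: add scale zero)
  then show ?thesis
    by (simp add: J_def)
qed

lemma lie_algebra_bms: "lie_algebra bms_scale bms_bracket"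
  by unfold_locales
    (use linear_bms_bracket_left linear_bms_bracket_right bms_bracket_self bms_jacobi in
      \<open>auto simp: Vector_Spaces.linear_iff\<close>)

section \<open>The modules $\Phi(\lambda,\alpha,\beta,\gamma,h(t))$\<close>

lemma coeff_in_t [simp]: "coeff (in_t p) i = (if i = 0 then p else 0)"
  by (simp add: in_t_def coeff_pCons split: nat.split)

lemma in_t_0 [simp]: "in_t 0 = 0" and in_t_1 [simp]: "in_t 1 = 1"
  by (simp_all add: in_t_def one_pCons)

lemma in_t_add: "in_t (p + q) = in_t p + in_t q"
  and in_t_diff: "in_t (p - q) = in_t p - in_t q"
  and in_t_mult: "in_t (p * q) = in_t p * in_t q"
  by (simp_all add: in_t_def mult.commute)

lemma in_t_of_int: "in_t (of_int n) = of_int n"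
  by (simp add: in_t_def of_int_poly)

lemma const_of_int: "in_t [:of_int n:] = of_int n"
  by (simp add: in_t_def of_int_poly)

lemma const_mult: "in_t [:c * d:] = in_t [:c:] * in_t [:d:]"
  by (simp add: in_t_def mult.commute)

lemma const_diff: "in_t [:c - d:] = in_t [:c:] - in_t [:d:]"
  and const_minus: "in_t [:- c:] = - in_t [:c:]"
  and const_1: "in_t [:1:] = 1"
  by (simp_all add: in_t_def one_pCons)

lemma in_t_smult: "in_t (smult c p) = in_t [:c:] * in_t p"
  by (simp flip: in_t_mult)

lemma scale_st_conv_mult: "scale_st c f = in_t [:c:] * f"
  by (simp add: scale_st_def in_t_def)

text \<open>The difference h - h(\<alpha>) has the root \<alpha>, so the division defining
  \<open>H_poly\<close> leaves no remainder.\<close>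

lemma H_poly_decomp: "h = [:- \<alpha>, 1:] * H_poly \<alpha> h + [:poly h \<alpha>:]"
proof -
  have "[:- \<alpha>, 1:] dvd h - [:poly h \<alpha>:]"
    by (simp add: dvd_iff_poly_eq_0)
  then have "[:- \<alpha>, 1:] * H_poly \<alpha> h = h - [:poly h \<alpha>:]"
    unfolding H_poly_def by (rule dvd_mult_div_cancel)
  then show ?thesis
    by (simp only: diff_add_cancel)
qed

lemma in_t_linear: "in_t [:- of_int n * \<alpha>, 1:] = in_t [:0, 1:] - of_int n * in_t [:\<alpha>:]"
  by (simp add: in_t_def of_int_poly)

text \<open>Substituting $h(t) = (t - \alpha) H(t) + h(\alpha)$ gives
  $h_{(n)}(t) = n (t - n \alpha) H(t) + n h(\alpha)$, which makes the dependence on $n$ explicit.\<close>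

lemma in_t_h_sub:
  "in_t (h_sub \<alpha> h n) = of_int n * ((in_t [:0, 1:] - of_int n * in_t [:\<alpha>:]) * in_t (H_poly \<alpha> h)
    + in_t [:poly h \<alpha>:])"
proof -
  \<comment> \<open>The factor \<open>of_int 1\<close> presents t - \<alpha> as the case n = 1 of
    \<open>in_t_linear\<close>.\<close>
  have "in_t h = in_t [:- of_int 1 * \<alpha>, 1:] * in_t (H_poly \<alpha> h) + in_t [:poly h \<alpha>:]"
    using arg_cong[OF H_poly_decomp, of in_t h \<alpha>] by (simp flip: in_t_add in_t_mult)
  then have h: "in_t h = (in_t [:0, 1:] - in_t [:\<alpha>:]) * in_t (H_poly \<alpha> h) + in_t [:poly h \<alpha>:]"
    unfolding in_t_linear by simp
  show ?thesis
    unfolding h_sub_def in_t_diff in_t_smult const_mult const_of_int h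
    by (simp add: algebra_simps)
qed

lemma shift_s_diff: "shift_s n (f - g) = shift_s n f - shift_s n g"
  by (simp add: shift_s_def pcompose_diff)

lemma shift_s_mult: "shift_s n (f * g) = shift_s n f * shift_s n g"
  by (simp add: shift_s_def pcompose_mult)

lemma shift_s_in_t [simp]: "shift_s n (in_t p) = in_t p"
  by (simp add: shift_s_def in_t_def)

lemma shift_s_of_int [simp]: "shift_s n (of_int m) = of_int m"
  using shift_s_in_t[of n "of_int m"] by (simp only: in_t_of_int)

lemma shift_s_var_s [simp]: "shift_s n var_s = var_s - of_int n"
  by (simp add: shift_s_def var_s_def pcompose_pCons of_int_poly)

lemma shift_s_shift_s: "shift_s m (shift_s n f) = shift_s (m + n) f"
  by (simp add: shift_s_def pcompose_pCons add.commute flip: pcompose_assoc)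

lemma shift_s_power: "shift_s n (f ^ i) = shift_s n f ^ i"
  by (induction i) (simp_all add: shift_s_mult, simp add: shift_s_def pcompose_1)

lemma coeff_deriv_t: "coeff (deriv_t f) i = pderiv (coeff f i)"
  by (simp add: deriv_t_def coeff_map_poly)

lemma deriv_t_diff: "deriv_t (f - g) = deriv_t f - deriv_t g"
  by (simp add: poly_eq_iff[where 'a = "complex poly"] coeff_deriv_t pderiv_diff)

lemma pderiv_sum: "pderiv (\<Sum>a\<in>A. f a) = (\<Sum>a\<in>A. pderiv (f a))"
  by (induction A rule: infinite_finite_induct) (simp_all add: pderiv_add)

lemma deriv_t_mult: "deriv_t (f * g) = deriv_t f * g + f * deriv_t g"
  by (simp add: poly_eq_iff[where 'a = "complex poly"] coeff_deriv_t coeff_mult pderiv_mult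
      pderiv_sum add.commute mult.commute[of "coeff g _"] flip: sum.distrib)

lemma deriv_t_in_t [simp]: "deriv_t (in_t p) = in_t (pderiv p)"
  by (simp add: poly_eq_iff[where 'a = "complex poly"] coeff_deriv_t)

lemma deriv_t_of_int [simp]: "deriv_t (of_int n) = 0"
  using deriv_t_in_t[of "[:of_int n:]"] by (simp add: const_of_int del: deriv_t_in_t)

lemma deriv_t_var_s [simp]: "deriv_t var_s = 0"
  by (simp add: poly_eq_iff[where 'a = "complex poly"] coeff_deriv_t var_s_def coeff_pCons
      split: nat.split)

lemma deriv_t_power_eq_0: "deriv_t f = 0 \<Longrightarrow> deriv_t (f ^ i) = 0"
  using deriv_t_of_int[of 1] by (induction i) (simp_all add: deriv_t_mult)

text \<open>The shift moves s only. The induction peels off the constant term in s; multiplicativity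
  of the shift and the Leibniz rule do the rest.\<close>

lemma deriv_t_shift_s: "deriv_t (shift_s n f) = shift_s n (deriv_t f)"
proof (induction f)
  case 0
  then show ?case by (simp add: shift_s_def deriv_t_def)
next
  case (pCons p f)
  have "pCons p f = in_t p + var_s * f"
    by (simp add: in_t_def var_s_def)
  then show ?case
    using pCons by (simp add: shift_s_add shift_s_mult deriv_t_add deriv_t_mult deriv_t_diff)
qed

text \<open>A normal form in which scalars, t and H are commuting ring elements and only
  \<open>shift_s\<close> and \<open>deriv_t\<close> act on f, so that commutators reduce to ring
  arithmetic.\<close>

lemma phi_basis_conv:
  defines "T \<equiv> in_t [:0, 1:]"
  shows
  "phi_basis lam \<alpha> \<beta> \<gamma> h (Lgen n) f = in_t [:lam powi n:] *
    ((var_s + of_int n * ((T - of_int n * in_t [:\<alpha>:]) * in_t (H_poly \<alpha> h) + in_t [:poly h \<alpha>:])) * shift_s n f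
      - of_int n * (T - of_int n * in_t [:\<alpha>:]) * shift_s n (deriv_t f))"
  "phi_basis lam \<alpha> \<beta> \<gamma> h (Wgen n) f =
    in_t [:lam powi n:] * ((T - of_int n * in_t [:\<alpha>:]) * shift_s n f)"
  "phi_basis lam \<alpha> \<beta> \<gamma> h (Igen n) f = in_t [:lam powi n:] *
    ((in_t [:\<gamma>:] - of_int n * in_t [:\<beta>:] * in_t (H_poly \<alpha> h)) * shift_s n f
      + of_int n * in_t [:\<beta>:] * shift_s n (deriv_t f))"
  "phi_basis lam \<alpha> \<beta> \<gamma> h (Jgen n) f = in_t [:lam powi n:] * (in_t [:\<beta>:] * shift_s n f)"
  by (simp_all only: phi_basis.simps scale_st_conv_mult deriv_t_shift_s in_t_h_sub in_t_linear
      T_def in_t_diff in_t_smult const_mult const_of_int)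
    (simp_all add: algebra_simps)

lemma phi_act_single: "phi_act lam \<alpha> \<beta> \<gamma> h (Poly_Mapping.single b c) f
  = scale_st c (phi_basis lam \<alpha> \<beta> \<gamma> h b f)"
  by (simp add: phi_act_def scale_st_def)

lemma linear_phi_act_left:
  "Vector_Spaces.linear bms_scale scale_st (\<lambda>x. phi_act lam \<alpha> \<beta> \<gamma> h x f)"
  unfolding phi_act_def by (rule linear_sum_keys[OF vector_space_scale_st])

interpretation phi_left: Vector_Spaces.linear bms_scale scale_st "\<lambda>x. phi_act lam \<alpha> \<beta> \<gamma> h x f"
  for lam \<alpha> \<beta> \<gamma> h f
  by (rule linear_phi_act_left)

interpretation phi_right: Vector_Spaces.linear scale_st scale_st "\<lambda>f. phi_act lam \<alpha> \<beta> \<gamma> h x f"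
  for lam \<alpha> \<beta> \<gamma> h x
  using linear_phi_act by simp

lemma phi_basis_bracket:
  assumes "lam \<noteq> 0"
  shows "phi_act lam \<alpha> \<beta> \<gamma> h (bms_basis_bracket a b) f
    = phi_basis lam \<alpha> \<beta> \<gamma> h a (phi_basis lam \<alpha> \<beta> \<gamma> h b f)
      - phi_basis lam \<alpha> \<beta> \<gamma> h b (phi_basis lam \<alpha> \<beta> \<gamma> h a f)"
proof -
  \<comment> \<open>For opposite indices the two powers must multiply to 1, which requires lam to be
    nonzero.\<close>
  have powi: "in_t [:lam powi (m + n):] = in_t [:lam powi m:] * in_t [:lam powi n:]" for m n
    by (simp add: power_int_add assms const_mult)
  show ?thesis
    by (cases a; cases b)
      (simp_all add: phi_act_single phi_left.neg phi_left.zero phi_basis_conv scale_st_conv_mult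
        shift_s_add shift_s_diff shift_s_mult shift_s_shift_s deriv_t_shift_s deriv_t_add
        deriv_t_diff deriv_t_mult const_of_int const_diff const_minus const_1 pderiv_pCons powi
        algebra_simps del: phi_basis.simps)
qed

lemma lie_module_phi:
  assumes "lam \<noteq> 0"
  shows "lie_module bms_scale bms_bracket scale_st (phi_act lam \<alpha> \<beta> \<gamma> h)"
proof -
  let ?\<phi> = "phi_act lam \<alpha> \<beta> \<gamma> h"
  \<comment> \<open>The failure of the bracket identity is bilinear in x and y, so it suffices that
    it vanishes on pairs of basis elements.\<close>
  define D where "D x y f = ?\<phi> (bms_bracket x y) f - (?\<phi> x (?\<phi> y f) - ?\<phi> y (?\<phi> x f))" for x y f
  have add: "D (x + x') y f = D x y f + D x' y f" "D x (y + y') f = D x y f + D x y' f" for x x' y y' f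
    by (simp_all add: D_def bms_bracket_bilinear phi_left.add phi_right.add algebra_simps)
  have scale: "D (bms_scale c x) y f = scale_st c (D x y f)"
    "D x (bms_scale c y) f = scale_st c (D x y f)" for c x y f
    by (simp_all add: D_def bms_bracket_bilinear phi_left.scale phi_right.scale scale_st_diff)
  have zero: "D 0 y f = 0" "D x 0 f = 0" "scale_st c 0 = 0" for x y f c
    by (simp_all add: D_def phi_left.zero phi_right.zero bracket_left.zero bracket_right.zero scale_st_def)
  have basis: "D (Poly_Mapping.single a 1) (Poly_Mapping.single b 1) f = 0" for a b f
    using phi_basis_bracket[OF assms]
    by (simp add: D_def bms_bracket_single_1 phi_act_single scale_st_def flip: one_pCons)
  have "D (Poly_Mapping.single a 1) y f = 0" for a y f
    by (induction y rule: bms_induct) (simp_all add: add scale zero basis)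
  then have "D x y f = 0" for x y f
    by (induction x rule: bms_induct) (simp_all add: add scale zero)
  then show ?thesis
    unfolding lie_module_def lie_module_axioms_def
    using lie_algebra_bms vector_space_scale_st linear_phi_act_left linear_phi_act
    by (auto simp: D_def)
qed

section \<open>Tensor products of modules\<close>

lemma vector_space_scale_sstt: "vector_space scale_sstt"
  by unfold_locales
    (simp_all add: scale_sstt_def smult_add_right mult.commute flip: smult_add_left one_pCons)

lemma tensor_scale: "scale_sstt c (f \<otimes>\<^sub>p g) = scale_st c f \<otimes>\<^sub>p g"
  by (rule sstt_eqI)
    (simp add: coeff_pure_tensor scale_sstt_def scale_st_def)

text \<open>Pure tensors span additively, and 0 is itself a pure tensor, so neither a zero case nor
  a scaling case is needed.\<close>

lemma sstt_pure_induct [case_names pure add]: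
  assumes "\<And>f g. P (f \<otimes>\<^sub>p g)" "\<And>F G. P F \<Longrightarrow> P G \<Longrightarrow> P (F + G)"
  shows "P F"
proof -
  have 0: "P 0"
    using assms(1)[of 0 0] by simp
  have sum: "P (\<Sum>a\<in>A. F a)" if "\<And>a. P (F a)" for A :: "nat set" and F
    using that 0 assms(2) by (induction A rule: infinite_finite_induct) auto
  show ?thesis
    by (subst pure_tensor_expansion) (intro sum assms(1))
qed

text \<open>The bounds in \<open>tensor_act\<close> depend on F. Beyond them the coefficients are 0
  and contribute nothing, so larger bounds common to several polynomials may be used.\<close>

lemma tensor_act_bounded:
  assumes "act2 x 0 = 0" "degree F \<le> m" "\<And>i. degree (coeff F i) \<le> n"
  shows "tensor_act act1 act2 x F = (\<Sum>i\<le>m. \<Sum>j\<le>n.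
        act1 x (monom_st i j) \<otimes>\<^sub>p coeff (coeff F i) j
        + monom_st i j \<otimes>\<^sub>p act2 x (coeff (coeff F i) j))"
proof -
  have "(\<Sum>j\<le>degree (coeff F i). act1 x (monom_st i j) \<otimes>\<^sub>p coeff (coeff F i) j
        + monom_st i j \<otimes>\<^sub>p act2 x (coeff (coeff F i) j))
    = (\<Sum>j\<le>n. act1 x (monom_st i j) \<otimes>\<^sub>p coeff (coeff F i) j
        + monom_st i j \<otimes>\<^sub>p act2 x (coeff (coeff F i) j))" for i
    using assms by (intro sum.mono_neutral_left) (auto simp: coeff_eq_0)
  then have "tensor_act act1 act2 x F = (\<Sum>i\<le>degree F. \<Sum>j\<le>n.
        act1 x (monom_st i j) \<otimes>\<^sub>p coeff (coeff F i) j
        + monom_st i j \<otimes>\<^sub>p act2 x (coeff (coeff F i) j))"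
    unfolding tensor_act_def by simp
  also have "\<dots> = (\<Sum>i\<le>m. \<Sum>j\<le>n. act1 x (monom_st i j) \<otimes>\<^sub>p coeff (coeff F i) j
        + monom_st i j \<otimes>\<^sub>p act2 x (coeff (coeff F i) j))"
    using assms by (intro sum.mono_neutral_left) (auto simp: coeff_eq_0)
  finally show ?thesis .
qed

lemma bounded_degree_coeff: "\<exists>n. \<forall>i. degree (coeff F i) \<le> n"
proof (intro exI allI)
  fix i
  show "degree (coeff F i) \<le> (\<Sum>i\<le>degree F. degree (coeff F i))"
  proof (cases "i \<le> degree F")
    case True
    then show ?thesis by (intro member_le_sum) auto
  qed (simp add: coeff_eq_0)
qed

text \<open>Expansions into pure tensors are not unique, so additivity is read off the defining sum
  with common bounds. Scaling may then be checked on pure tensors.\<close>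

lemma linear_tensor_act:
  assumes "Vector_Spaces.linear scale_st scale_st (act1 x)"
    and "Vector_Spaces.linear scale_st scale_st (act2 x)"
  shows "Vector_Spaces.linear scale_sstt scale_sstt (tensor_act act1 act2 x)"
proof -
  interpret act2: Vector_Spaces.linear scale_st scale_st "act2 x" by fact
  have add: "tensor_act act1 act2 x (F + G) = tensor_act act1 act2 x F + tensor_act act1 act2 x G" for F G
  proof -
    obtain n1 n2 where n: "\<And>i. degree (coeff F i) \<le> n1" "\<And>i. degree (coeff G i) \<le> n2"
      using bounded_degree_coeff by metis
    define m where "m = max (degree F) (degree G)"
    define n where "n = max n1 n2"
    have "degree F \<le> m" "degree G \<le> m" "degree (F + G) \<le> m"
      by (auto simp: m_def intro: degree_add_le)
    moreover have "degree (coeff F i) \<le> n" "degree (coeff G i) \<le> n" "degree (coeff (F + G) i) \<le> n" for i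
      using n[of i] by (auto simp: n_def intro: degree_add_le)
    ultimately show ?thesis
      by (simp add: tensor_act_bounded[where m = m and n = n] act2.zero act2.add
          pure_tensor_add_right sum.distrib algebra_simps)
  qed
  have "tensor_act act1 act2 x (scale_sstt c F) = scale_sstt c (tensor_act act1 act2 x F)" for c F
  proof (induction F rule: sstt_pure_induct)
    case (pure f g)
    have scale_right: "scale_sstt c (f \<otimes>\<^sub>p g) = f \<otimes>\<^sub>p scale_st c g" for f g
      by (simp add: tensor_scale pure_tensor_scale)
    show ?case
      using assms by (simp add: scale_right tensor_act_pure act2.scale
          vector_space.vector_space_assms[OF vector_space_scale_sstt])
  next
    case (add F G)
    then show ?case
      by (simp add: \<open>\<And>F G. tensor_act act1 act2 x (F + G) = _\<close>
          vector_space.vector_space_assms[OF vector_space_scale_sstt])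
  qed
  with add show ?thesis
    by (intro linearI_vs vector_space_scale_sstt)
qed

text \<open>On a pure tensor the mixed terms xf \<otimes> yg and yf \<otimes> xg occur in both
  orders of acting and cancel in the commutator; additivity covers the rest.\<close>

lemma lie_module_tensor:
  assumes "lie_module sc br scale_st act1" "lie_module sc br scale_st act2"
  shows "lie_module sc br scale_sstt (tensor_act act1 act2)"
proof -
  interpret m1: lie_module sc br scale_st act1 by fact
  interpret m2: lie_module sc br scale_st act2 by fact
  note lin = m1.act_linear_right m2.act_linear_right
  interpret T: Vector_Spaces.linear scale_sstt scale_sstt "tensor_act act1 act2 x" for x
    by (intro linear_tensor_act lin)
  interpret l1: Vector_Spaces.linear sc scale_st "\<lambda>x. act1 x f" for f
    by (rule m1.act_linear_left)
  interpret l2: Vector_Spaces.linear sc scale_st "\<lambda>x. act2 x f" for f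
    by (rule m2.act_linear_left)
  have pure: "tensor_act act1 act2 x (f \<otimes>\<^sub>p g) = act1 x f \<otimes>\<^sub>p g + f \<otimes>\<^sub>p act2 x g" for x f g
    by (intro tensor_act_pure lin)
  have diff: "(f - f') \<otimes>\<^sub>p g = f \<otimes>\<^sub>p g - f' \<otimes>\<^sub>p g"
    "f \<otimes>\<^sub>p (g - g') = f \<otimes>\<^sub>p g - f \<otimes>\<^sub>p g'" for f f' g g'
    by (simp_all only: eq_diff_eq flip: pure_tensor_add_left pure_tensor_add_right)
      (simp_all only: diff_add_cancel)
  have "tensor_act act1 act2 (br x y) F = tensor_act act1 act2 x (tensor_act act1 act2 y F)
      - tensor_act act1 act2 y (tensor_act act1 act2 x F)" for x y F
    by (induction F rule: sstt_pure_induct)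
      (simp_all add: T.add pure m1.act_bracket m2.act_bracket diff)
  moreover have "Vector_Spaces.linear sc scale_sstt (\<lambda>x. tensor_act act1 act2 x F)" for F
  proof (rule linearI_vs[OF m1.vector_space_axioms vector_space_scale_sstt])
    fix x y c
    show "tensor_act act1 act2 (x + y) F = tensor_act act1 act2 x F + tensor_act act1 act2 y F"
      by (induction F rule: sstt_pure_induct)
        (simp_all add: T.add pure l1.add l2.add pure_tensor_add_left pure_tensor_add_right)
    show "tensor_act act1 act2 (sc c x) F = scale_sstt c (tensor_act act1 act2 x F)"
      by (induction F rule: sstt_pure_induct)
        (simp_all add: T.add pure l1.scale l2.scale tensor_scale pure_tensor_scale
          vector_space.vector_space_assms[OF vector_space_scale_sstt])
  qed
  ultimately show ?thesis
    unfolding lie_module_def lie_module_axioms_def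
    using m1.lie_algebra_axioms vector_space_scale_sstt T.linear_axioms by auto
qed

section \<open>The subspaces $N_l$\<close>

lemma map_poly_add_hom:
  assumes "h 0 = 0" "\<And>a b. h (a + b) = h a + h b"
  shows "map_poly h (p + q) = map_poly h p + map_poly h q"
  using assms by (simp add: poly_eq_iff coeff_map_poly)

lemma map_poly_mult_hom:
  fixes h :: "'a::comm_semiring_0 \<Rightarrow> 'b::comm_semiring_0"
  assumes "h 0 = 0" "\<And>a b. h (a + b) = h a + h b" "\<And>a b. h (a * b) = h a * h b"
  shows "map_poly h (p * q) = map_poly h p * map_poly h q"
proof -
  have sum: "h (\<Sum>a\<in>A. f a) = (\<Sum>a\<in>A. h (f a))" for f :: "nat \<Rightarrow> 'a" and A
    by (induction A rule: infinite_finite_induct) (simp_all add: assms)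
  show ?thesis
    using assms by (simp add: poly_eq_iff coeff_map_poly coeff_mult sum)
qed

lemma emb1_add: "emb1 (f + g) = emb1 f + emb1 g"
  unfolding emb1_def by (intro map_poly_add_hom) simp_all

lemma emb1_mult: "emb1 (f * g) = emb1 f * emb1 g"
  unfolding emb1_def by (intro map_poly_mult_hom map_poly_add_hom) (simp_all add: mult.commute)

lemma emb1_in_t: "emb1 (in_t p) = [:map_poly (\<lambda>c. [:[:c:]:]) p:]"
  by (rule sstt_eqI) (simp add: coeff_emb1 coeff_pCons coeff_map_poly split: nat.split)

lemma emb1_1 [simp]: "emb1 1 = 1"
  using emb1_in_t[of 1] by (simp add: map_poly_1 flip: one_pCons)

lemma emb1_diff: "emb1 (f - g) = emb1 f - emb1 g"
  using emb1_add[of "f - g" g] by (simp add: eq_diff_eq)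

lemma emb1_power: "emb1 (f ^ n) = emb1 f ^ n"
  by (induction n) (simp_all add: emb1_mult)

lemma const_emb1: "emb1 (in_t [:c:]) = [:[:[:[:c:]:]:]:]"
  by (simp add: emb1_in_t map_poly_pCons)

lemma emb1_of_int [simp]: "emb1 (of_int n) = of_int n"
  using const_emb1[of "of_int n"] by (simp add: const_of_int of_int_poly)

lemma emb2_simps:
  "emb2 (f + g) = emb2 f + emb2 g" "emb2 (f - g) = emb2 f - emb2 g"
  "emb2 (f * g) = emb2 f * emb2 g" "emb2 1 = 1" "emb2 (of_int n) = of_int n"
  by (simp_all add: emb2_def mult.commute one_pCons of_int_poly)

lemma emb2_power: "emb2 (f ^ n) = emb2 f ^ n"
  by (induction n) (simp_all add: emb2_simps)

lemma const_emb2: "emb2 (in_t [:c:]) = emb1 (in_t [:c:])"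
  unfolding const_emb1 by (simp add: emb2_def in_t_def)

lemma scale_sstt_conv_mult: "scale_sstt c F = emb1 (in_t [:c:]) * F"
  by (simp add: scale_sstt_def const_emb1)

lemma emb_tt_0 [simp]: "emb_tt 0 = 0"
  by (simp add: emb_tt_def)

lemma emb_tt_add: "emb_tt (g + g') = emb_tt g + emb_tt g'"
  by (simp add: emb_tt_def map_poly_add_hom in_t_add)

lemma emb_tt_outer: "emb1 (in_t p) * emb2 (in_t q) = emb_tt (map_poly (\<lambda>c. smult c q) p)"
  unfolding pure_tensor_def[symmetric]
  by (rule sstt_eqI)
    (auto simp: coeff_pure_tensor emb_tt_def coeff_map_poly coeff_pCons scale_st_def in_t_def split: nat.split)

text \<open>Sums of products p(t1) q(t2) exhaust C[t1,t2]: each monomial in t1 with coefficient in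
  C[t2] is already such a product.\<close>

lemma emb_tt_induct [case_names outer add]:
  assumes "\<And>p q. P (emb1 (in_t p) * emb2 (in_t q))" "\<And>F G. P F \<Longrightarrow> P G \<Longrightarrow> P (F + G)"
  shows "P (emb_tt g)"
proof -
  have 0: "P 0"
    using assms(1)[of 0 0] by (simp add: emb2_def)
  have monom: "P (emb_tt (monom p i))" for p i
  proof -
    have "map_poly (\<lambda>c. smult c p) (monom 1 i) = monom p i"
      by (simp add: map_poly_monom)
    with assms(1)[of "monom 1 i" p] show ?thesis
      by (simp add: emb_tt_outer)
  qed
  have sum: "P (emb_tt (\<Sum>i\<in>A. G i))" if "\<And>i. P (emb_tt (G i))" for A :: "nat set" and G
    using that 0 assms(2) by (induction A rule: infinite_finite_induct) (auto simp: emb_tt_add)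
  have "P (emb_tt (\<Sum>i\<le>degree g. monom (coeff g i) i))"
    by (intro sum monom)
  then show ?thesis
    by (simp add: poly_as_sum_of_monoms)
qed

section \<open>Closure of N_l under multiplication\<close>

interpretation sstt: vector_space scale_sstt
  by (rule vector_space_scale_sstt)

lemma N_sub_base: "r \<le> l \<Longrightarrow> emb1 var_s ^ r * (emb1 var_s + emb2 var_s) ^ u * emb_tt g \<in> N_sub l"
  unfolding N_sub_def by (intro sstt.span_base) blast

lemmas N_sub_closed = sstt.span_zero sstt.span_add sstt.span_diff sstt.span_scale
lemmas N_sub_intros = N_sub_closed[where
    S = "{emb1 var_s ^ r * (emb1 var_s + emb2 var_s) ^ u * emb_tt g | r u g. r \<le> l}" for l,
  folded N_sub_def]

lemma N_sub_induct [consumes 1, case_names zero step]: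
  assumes "F \<in> N_sub l" "P 0"
    and "\<And>r u g c F. r \<le> l \<Longrightarrow> P F \<Longrightarrow>
      P (scale_sstt c (emb1 var_s ^ r * (emb1 var_s + emb2 var_s) ^ u * emb_tt g) + F)"
  shows "P F"
  using assms unfolding N_sub_def by (induction F rule: sstt.span_induct_alt) auto

text \<open>Multiplication by Z is linear, so generators suffice. The target index may differ, which
  covers factors that raise the degree in s1.\<close>

lemma N_sub_mult:
  assumes "F \<in> N_sub l"
    and "\<And>r u g. r \<le> l \<Longrightarrow> Z * (emb1 var_s ^ r * (emb1 var_s + emb2 var_s) ^ u * emb_tt g) \<in> N_sub l'"
  shows "Z * F \<in> N_sub l'"
  using assms(1)
proof (induction F rule: N_sub_induct)
  case (step r u g c F)
  have "Z * (scale_sstt c G + F) = scale_sstt c (Z * G) + Z * F" for G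
    by (simp add: scale_sstt_def distrib_left)
  with step assms(2) show ?case
    by (simp add: N_sub_intros)
qed (simp add: N_sub_intros)

lemma N_sub_mono: "l \<le> l' \<Longrightarrow> F \<in> N_sub l \<Longrightarrow> F \<in> N_sub l'"
  using N_sub_mult[of F l 1 l'] N_sub_base by simp

lemma N_sub_mult_s1: "F \<in> N_sub l \<Longrightarrow> emb1 var_s * F \<in> N_sub (Suc l)"
  by (erule N_sub_mult) (use N_sub_base[of "Suc _"] in \<open>simp add: mult_ac\<close>)

lemma N_sub_mult_s1_s2: "F \<in> N_sub l \<Longrightarrow> (emb1 var_s + emb2 var_s) * F \<in> N_sub l"
proof (erule N_sub_mult)
  fix r u g assume "r \<le> l"
  then have "emb1 var_s ^ r * (emb1 var_s + emb2 var_s) ^ Suc u * emb_tt g \<in> N_sub l"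
    by (rule N_sub_base)
  then show "(emb1 var_s + emb2 var_s) * (emb1 var_s ^ r * (emb1 var_s + emb2 var_s) ^ u * emb_tt g) \<in> N_sub l"
    by (simp only: power_Suc mult_ac)
qed

lemma N_sub_mult_of_int: "F \<in> N_sub l \<Longrightarrow> of_int n * F \<in> N_sub l"
  using N_sub_intros(4)[of F l "of_int n"] by (simp add: scale_sstt_conv_mult const_of_int)

text \<open>Generators admit every power of s1 + s2, so this factor, unlike s1, costs nothing in the
  index l.\<close>

lemma N_sub_shift_s1_s2: "F \<in> N_sub l \<Longrightarrow> (emb1 var_s + emb2 var_s - of_int n) ^ u * F \<in> N_sub l"
proof (induction u)
  case (Suc u)
  let ?F = "(emb1 var_s + emb2 var_s - of_int n) ^ u * F"
  have "(emb1 var_s + emb2 var_s) * ?F - of_int n * ?F \<in> N_sub l"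
    using Suc by (intro N_sub_intros N_sub_mult_s1_s2 N_sub_mult_of_int) auto
  then show ?case
    by (simp add: algebra_simps)
qed simp

lemma N_sub_power_s1: "F \<in> N_sub l \<Longrightarrow> emb1 var_s ^ r * F \<in> N_sub (r + l)"
  by (induction r) (auto dest: N_sub_mult_s1 simp: mult.assoc)

lemma N_sub_shift_s1: "F \<in> N_sub 0 \<Longrightarrow> (emb1 var_s - of_int n) ^ r * F \<in> N_sub r"
proof (induction r)
  case (Suc r)
  let ?F = "(emb1 var_s - of_int n) ^ r * F"
  have "emb1 var_s * ?F - of_int n * ?F \<in> N_sub (Suc r)"
    using Suc by (intro N_sub_intros N_sub_mult_s1 N_sub_mult_of_int N_sub_mono[of r "Suc r"]) auto
  then show ?case
    by (simp add: algebra_simps)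
qed simp

text \<open>The leading powers of $s_1$ cancel, so multiplying by $s_1$ does not raise the degree.\<close>

lemma N_sub_shift_diff:
  "F \<in> N_sub 0 \<Longrightarrow> emb1 var_s * (((emb1 var_s - of_int n) ^ r - emb1 var_s ^ r) * F) \<in> N_sub r"
proof (induction r)
  case (Suc r)
  let ?F = "emb1 var_s * (((emb1 var_s - of_int n) ^ r - emb1 var_s ^ r) * F)"
  \<comment> \<open>With A = (s1 - n)^r and B = s1^r, the next difference is (s1 - n)(A - B) - n B;
    multiplied by s1 F it gives these three terms.\<close>
  have "emb1 var_s * ?F - of_int n * ?F - of_int n * (emb1 var_s ^ Suc r * F) \<in> N_sub (Suc r)"
    using N_sub_mult_s1[OF Suc.IH[OF Suc.prems]] N_sub_mono[OF _ Suc.IH[OF Suc.prems], of "Suc r"]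
      N_sub_power_s1[OF Suc.prems, of "Suc r"]
    by (intro N_sub_intros N_sub_mult_of_int) simp_all
  then show ?case
    by (simp add: algebra_simps)
qed (simp add: N_sub_intros)

section \<open>Invariance of N_l under the action\<close>

text \<open>On $s^i p(t)$ every basis element acts as the shift by $n$ combined with a multiple $k$ of
  multiplication by $s$; the constants $n$ and $k$ do not depend on $\alpha,\beta,\gamma,h$ and are
  therefore shared by the two tensor factors.\<close>

lemma phi_basis_power:
  "\<exists>n k. \<forall>\<alpha> \<beta> \<gamma> h. \<exists>Y. \<forall>i p. phi_basis lam \<alpha> \<beta> \<gamma> h b (var_s ^ i * in_t p)
     = (var_s - of_int n) ^ i * (in_t [:k:] * var_s * in_t p + in_t (Y p))"
proof -
  let ?P = "\<lambda>n k \<alpha> \<beta> \<gamma> h Y. \<forall>i p. phi_basis lam \<alpha> \<beta> \<gamma> h b (var_s ^ i * in_t p)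
     = (var_s - of_int n) ^ i * (in_t [:k:] * var_s * in_t p + in_t (Y p))"
  show ?thesis
  proof (cases b)
    case (Lgen n)
    \<comment> \<open>Only the L generators multiply by s, hence k = 0 in the other cases. Y gathers
      the s-free terms; the t-derivative leaves powers of s alone.\<close>
    have "\<exists>Y. ?P n (lam powi n) \<alpha> \<beta> \<gamma> h Y" for \<alpha> \<beta> \<gamma> h
      unfolding Lgen
      by (rule exI[of _ "\<lambda>p. [:lam powi n:] * (h_sub \<alpha> h n * p
          - [:of_int n:] * ([:- of_int n * \<alpha>, 1:] * pderiv p))"])
        (simp_all add: scale_st_conv_mult const_mult const_of_int shift_s_mult shift_s_power deriv_t_mult
          deriv_t_power_eq_0 deriv_t_diff in_t_add in_t_mult in_t_diff in_t_smult algebra_simps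
          del: mult_pCons_left mult_pCons_right)
    then show ?thesis
      by blast
  next
    case (Wgen n)
    have "\<exists>Y. ?P n 0 \<alpha> \<beta> \<gamma> h Y" for \<alpha> \<beta> \<gamma> h
      unfolding Wgen
      by (rule exI[of _ "\<lambda>p. [:lam powi n:] * ([:- of_int n * \<alpha>, 1:] * p)"])
        (simp_all add: scale_st_conv_mult const_mult const_of_int shift_s_mult shift_s_power deriv_t_mult
          deriv_t_power_eq_0 deriv_t_diff in_t_add in_t_mult in_t_diff in_t_smult algebra_simps
          del: mult_pCons_left mult_pCons_right)
    then show ?thesis
      by blast
  next
    case (Igen n)
    have "\<exists>Y. ?P n 0 \<alpha> \<beta> \<gamma> h Y" for \<alpha> \<beta> \<gamma> h
      unfolding Igen
      by (rule exI[of _ "\<lambda>p. [:lam powi n:] * (([:\<gamma>:] - [:of_int n * \<beta>:] * (H_poly \<alpha> h)) * p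
          + [:of_int n * \<beta>:] * pderiv p)"])
        (simp_all add: scale_st_conv_mult const_mult const_of_int shift_s_mult shift_s_power deriv_t_mult
          deriv_t_power_eq_0 deriv_t_diff in_t_add in_t_mult in_t_diff in_t_smult algebra_simps
          del: mult_pCons_left mult_pCons_right)
    then show ?thesis
      by blast
  next
    case (Jgen n)
    have "\<exists>Y. ?P n 0 \<alpha> \<beta> \<gamma> h Y" for \<alpha> \<beta> \<gamma> h
      unfolding Jgen
      by (rule exI[of _ "\<lambda>p. [:lam powi n * \<beta>:] * p"])
        (simp_all add: scale_st_conv_mult const_mult const_of_int shift_s_mult shift_s_power deriv_t_mult
          deriv_t_power_eq_0 deriv_t_diff in_t_add in_t_mult in_t_diff in_t_smult algebra_simps
          del: mult_pCons_left mult_pCons_right)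
    then show ?thesis
      by blast
  qed
qed

text \<open>By linearity x may be a basis element, F a generator and g a product p(t1) q(t2). Such
  an F is expanded into pure tensors, acted on, and summed up again.\<close>

lemma phi_tensor_act_N_sub:
  assumes "lam \<noteq> 0" "F \<in> N_sub l"
  shows "phi_tensor_act lam \<alpha>\<^sub>1 \<beta>\<^sub>1 \<gamma>\<^sub>1 h\<^sub>1 \<alpha>\<^sub>2 \<beta>\<^sub>2 \<gamma>\<^sub>2 h\<^sub>2 x F \<in> N_sub l"
proof -
  let ?T = "phi_tensor_act lam \<alpha>\<^sub>1 \<beta>\<^sub>1 \<gamma>\<^sub>1 h\<^sub>1 \<alpha>\<^sub>2 \<beta>\<^sub>2 \<gamma>\<^sub>2 h\<^sub>2"
  let ?s1 = "emb1 var_s" and ?s2 = "emb2 var_s"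
  interpret T: lie_module bms_scale bms_bracket scale_sstt ?T
    unfolding phi_tensor_act_def by (intro lie_module_tensor lie_module_phi assms)
  interpret left: Vector_Spaces.linear bms_scale scale_sstt "\<lambda>y. ?T y G" for G
    by (rule T.act_linear_left)
  interpret right: Vector_Spaces.linear scale_sstt scale_sstt "\<lambda>G. ?T y G" for y
    by (rule T.act_linear_right)
  have outer: "?T (Poly_Mapping.single b 1) (?s1 ^ r * (?s1 + ?s2) ^ u * (emb1 (in_t p) * emb2 (in_t q))) \<in> N_sub r"
    for b r u p q
  proof -
    obtain n k where nk: "\<And>\<alpha> \<beta> \<gamma> h. \<exists>Y. \<forall>i p. phi_basis lam \<alpha> \<beta> \<gamma> h b (var_s ^ i * in_t p)
      = (var_s - of_int n) ^ i * (in_t [:k:] * var_s * in_t p + in_t (Y p))"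
      using phi_basis_power[of lam b] by blast
    obtain Y1 where Y1: "\<And>i p. phi_basis lam \<alpha>\<^sub>1 \<beta>\<^sub>1 \<gamma>\<^sub>1 h\<^sub>1 b (var_s ^ i * in_t p)
      = (var_s - of_int n) ^ i * (in_t [:k:] * var_s * in_t p + in_t (Y1 p))"
      using nk by meson
    obtain Y2 where Y2: "\<And>i p. phi_basis lam \<alpha>\<^sub>2 \<beta>\<^sub>2 \<gamma>\<^sub>2 h\<^sub>2 b (var_s ^ i * in_t p)
      = (var_s - of_int n) ^ i * (in_t [:k:] * var_s * in_t p + in_t (Y2 p))"
      using nk by meson
    have scale_of_nat: "scale_sstt (of_nat m) F = of_nat m * F" for m F
      by (simp add: scale_sstt_def of_nat_poly)
    let ?x = "Poly_Mapping.single b 1"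
    let ?K = "emb1 (in_t [:k:])" and ?P = "emb1 (in_t p)" and ?Q = "emb2 (in_t q)"
      and ?P' = "emb1 (in_t (Y1 p))" and ?Q' = "emb2 (in_t (Y2 q))" and ?n = "of_int n :: poly_sstt"
    \<comment> \<open>The action is known explicitly on pure tensors only, so (s1 + s2)^u is split
      by the binomial theorem.\<close>
    have expand: "?s1 ^ r * (?s1 + ?s2) ^ u * (?P * ?Q) = (\<Sum>j\<le>u. scale_sstt (of_nat (u choose j))
        ((var_s ^ (r + j) * in_t p) \<otimes>\<^sub>p (var_s ^ (u - j) * in_t q)))"
      unfolding binomial_ring sum_distrib_left sum_distrib_right
      by (intro sum.cong refl)
        (simp add: pure_tensor_def emb1_mult emb1_power emb2_simps emb2_power power_add
          scale_sstt_def of_nat_poly algebra_simps)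
    have pure: "?T ?x ((var_s ^ i * in_t p) \<otimes>\<^sub>p (var_s ^ j * in_t q))
      = (?s1 - ?n) ^ i * ?s2 ^ j * (?K * ?s1 * ?P + ?P') * ?Q
        + ?s1 ^ i * (?s2 - ?n) ^ j * (?K * ?s2 * ?Q + ?Q') * ?P" for i j
      unfolding phi_tensor_act_pure phi_act_single Y1 Y2
      by (simp add: pure_tensor_def scale_st_conv_mult const_1 emb1_mult emb1_add emb1_diff emb1_power
          emb2_simps emb2_power const_emb2 algebra_simps)
    have "?T ?x (?s1 ^ r * (?s1 + ?s2) ^ u * (?P * ?Q)) = (\<Sum>j\<le>u. of_nat (u choose j) *
        ((?s1 - ?n) ^ (r + j) * ?s2 ^ (u - j) * (?K * ?s1 * ?P + ?P') * ?Q
        + ?s1 ^ (r + j) * (?s2 - ?n) ^ (u - j) * (?K * ?s2 * ?Q + ?Q') * ?P))"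
      by (simp only: expand right.sum right.scale pure) (simp only: scale_of_nat)
    \<comment> \<open>The binomial theorem backwards: shifting s1 in one sum and s2 in the other
      both turn (s1 + s2)^u into (s1 + s2 - n)^u.\<close>
    also have "\<dots> = (?s1 - ?n) ^ r * ((?s1 - ?n) + ?s2) ^ u * (?K * ?s1 * ?P + ?P') * ?Q
        + ?s1 ^ r * (?s1 + (?s2 - ?n)) ^ u * (?K * ?s2 * ?Q + ?Q') * ?P"
      unfolding binomial_ring sum_distrib_left sum_distrib_right sum.distrib[symmetric]
      by (intro sum.cong refl) (simp add: power_add algebra_simps)
    also have "\<dots> = (?s1 + ?s2 - ?n) ^ u * (?s1 * (((?s1 - ?n) ^ r - ?s1 ^ r) * (?K * (?P * ?Q)))
        + (?s1 + ?s2) * (?s1 ^ r * (?K * (?P * ?Q)))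
        + (?s1 - ?n) ^ r * (?P' * ?Q) + ?s1 ^ r * (?P * ?Q'))"
    proof -
      have "?s1 - ?n + ?s2 = ?s1 + ?s2 - ?n" "?s1 + (?s2 - ?n) = ?s1 + ?s2 - ?n"
        by simp_all
      \<comment> \<open>Here A, B and S stand for (s1 - n)^r, s1^r and (s1 + s2 - n)^u. Stated for
        free variables, the identity is checked without expanding any power.\<close>
      moreover have "A * S * (K * s1 * P + P') * Q + B * S * (K * s2 * Q + Q') * P =
        S * (s1 * ((A - B) * (K * (P * Q))) + (s1 + s2) * (B * (K * (P * Q))) + A * (P' * Q) + B * (P * Q'))"
        for A B S K s1 s2 P P' Q Q' :: poly_sstt
        by (simp add: algebra_simps)
      ultimately show ?thesis
        by (simp only:)
    qed
    also have "\<dots> \<in> N_sub r"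
    proof -
      have base: "emb1 (in_t p) * emb2 (in_t q) \<in> N_sub 0" for p q
        using N_sub_base[of 0 0 0] by (simp add: emb_tt_outer)
      have const: "?K * (?P * ?Q) \<in> N_sub 0"
        using N_sub_intros(4)[OF base] by (simp add: scale_sstt_conv_mult)
      have s1_power: "?s1 ^ r * G \<in> N_sub r" if "G \<in> N_sub 0" for G
        using N_sub_power_s1[OF that, of r] by simp
      show ?thesis
        by (intro N_sub_shift_s1_s2 N_sub_intros N_sub_shift_diff N_sub_mult_s1_s2 N_sub_shift_s1
            s1_power const base)
    qed
    finally show ?thesis .
  qed
  have basis: "?T (Poly_Mapping.single b 1) (?s1 ^ r * (?s1 + ?s2) ^ u * emb_tt g) \<in> N_sub r" for b r u g
    by (induction rule: emb_tt_induct) (simp_all add: outer distrib_left right.add N_sub_intros)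
  have gen: "?T (Poly_Mapping.single b 1) F \<in> N_sub l" for b
    using assms(2)
  proof (induction F rule: N_sub_induct)
    case (step r u g c F)
    then show ?case
      \<comment> \<open>The image of a generator lies in N_r for its own exponent r, and r is at
        most l.\<close>
      using N_sub_mono[OF _ basis] by (simp add: right.add right.scale N_sub_intros)
  qed (simp add: right.zero N_sub_intros)
  show ?thesis
    by (induction x rule: bms_induct) (simp_all add: left.zero left.add left.scale gen N_sub_intros)
qed

section \<open>Properness of N_l\<close>

text \<open>Evaluation at $s_1 = a$, $s_2 = -a$, $t_1 = t_2 = 0$, the variables being nested in the order
  $s_1, t_1, s_2, t_2$.\<close>

definition eval_antidiag :: "complex \<Rightarrow> poly_sstt \<Rightarrow> complex" where
  "eval_antidiag a F = poly (poly (poly (poly F [:[:[:a:]:]:]) 0) [:- a:]) 0"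

lemma eval_antidiag_simps:
  "eval_antidiag a (F + G) = eval_antidiag a F + eval_antidiag a G"
  "eval_antidiag a (F * G) = eval_antidiag a F * eval_antidiag a G"
  "eval_antidiag a (F ^ n) = eval_antidiag a F ^ n"
  "eval_antidiag a (scale_sstt c F) = c * eval_antidiag a F"
  by (simp_all add: eval_antidiag_def scale_sstt_def)

lemma eval_antidiag_vars:
  "eval_antidiag a (emb1 var_s) = a" "eval_antidiag a (emb2 var_s) = - a"
  by (simp_all add: eval_antidiag_def emb1_def emb2_def var_s_def map_poly_pCons map_poly_1)

lemma eval_antidiag_emb_tt: "eval_antidiag a (emb_tt g) = coeff (coeff g 0) 0"
  by (simp add: eval_antidiag_def emb_tt_def poly_0_coeff_0 coeff_map_poly in_t_def)

text \<open>On the antidiagonal s1 + s2 vanishes, so a generator becomes a constant multiple of a^r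
  with r at most l. One polynomial p has to work for all a.\<close>

lemma N_sub_eval_antidiag:
  assumes "F \<in> N_sub l"
  shows "\<exists>p. degree p \<le> l \<and> (\<forall>a. eval_antidiag a F = poly p a)"
  using assms
proof (induction F rule: N_sub_induct)
  case zero
  show ?case
    by (rule exI[of _ 0]) (simp add: eval_antidiag_def)
next
  case (step r u g c F)
  then obtain p where p: "degree p \<le> l" "\<And>a. eval_antidiag a F = poly p a"
    by blast
  \<comment> \<open>The factor \<open>0 ^ u\<close> is 1 for u = 0 and 0 otherwise, so only
    generators without s1 + s2 survive.\<close>
  let ?q = "monom (c * 0 ^ u * coeff (coeff g 0) 0) r"
  have "degree (?q + p) \<le> l"
    using p(1) step.hyps by (intro degree_add_le) (auto intro: order.trans[OF degree_monom_le])
  moreover have "eval_antidiag a (scale_sstt c (emb1 var_s ^ r * (emb1 var_s + emb2 var_s) ^ u * emb_tt g) + F)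
      = poly (?q + p) a" for a
    by (simp add: eval_antidiag_simps eval_antidiag_vars eval_antidiag_emb_tt p(2) poly_monom)
  ultimately show ?case
    by blast
qed

lemma N_sub_proper: "N_sub l \<noteq> UNIV"
proof
  assume "N_sub l = UNIV"
  then obtain p where p: "degree p \<le> l" "\<And>a. eval_antidiag a (emb1 var_s ^ Suc l) = poly p a"
    using N_sub_eval_antidiag[of "emb1 var_s ^ Suc l" l] by blast
  then have "poly p = poly (monom 1 (Suc l))"
    by (simp add: fun_eq_iff eval_antidiag_simps eval_antidiag_vars poly_monom)
  \<comment> \<open>Polynomials over an infinite field are determined by their values.\<close>
  then have "p = monom 1 (Suc l)"
    by (simp only: poly_eq_poly_eq_iff)
  with p(1) show False
    by (simp add: degree_monom_eq)
qed

theorem proposition3p5: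
  fixes lam \<alpha>\<^sub>1 \<beta>\<^sub>1 \<gamma>\<^sub>1 \<alpha>\<^sub>2 \<beta>\<^sub>2 \<gamma>\<^sub>2 :: complex
    and h\<^sub>1 h\<^sub>2 :: "complex poly"
    and l :: nat
  assumes "lam \<noteq> 0"
    and "\<alpha>\<^sub>1 \<noteq> 0 \<or> \<beta>\<^sub>1 \<noteq> 0"
    and "\<alpha>\<^sub>2 \<noteq> 0 \<or> \<beta>\<^sub>2 \<noteq> 0"
  shows "lie_submodule bms_scale bms_bracket scale_sstt
           (phi_tensor_act lam \<alpha>\<^sub>1 \<beta>\<^sub>1 \<gamma>\<^sub>1 h\<^sub>1 \<alpha>\<^sub>2 \<beta>\<^sub>2 \<gamma>\<^sub>2 h\<^sub>2) (N_sub l)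
         \<and> N_sub l \<noteq> UNIV"
proof
  have "lie_module bms_scale bms_bracket scale_sstt
      (phi_tensor_act lam \<alpha>\<^sub>1 \<beta>\<^sub>1 \<gamma>\<^sub>1 h\<^sub>1 \<alpha>\<^sub>2 \<beta>\<^sub>2 \<gamma>\<^sub>2 h\<^sub>2)"
    unfolding phi_tensor_act_def by (intro lie_module_tensor lie_module_phi assms)
  moreover have "sstt.subspace (N_sub l)"
    unfolding N_sub_def by (rule sstt.subspace_span)
  ultimately show "lie_submodule bms_scale bms_bracket scale_sstt
      (phi_tensor_act lam \<alpha>\<^sub>1 \<beta>\<^sub>1 \<gamma>\<^sub>1 h\<^sub>1 \<alpha>\<^sub>2 \<beta>\<^sub>2 \<gamma>\<^sub>2 h\<^sub>2) (N_sub l)"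
    using phi_tensor_act_N_sub[OF assms(1)]
    by (simp add: lie_submodule_def lie_submodule_axioms_def)
qed (rule N_sub_proper)

end
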